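(* Let $\mathcal C\le\mathbb F_{q^m}^n$ be an $\mathbb F_{q^m}$-linear rank metric code and $\mathcal M$ its induced $q$-matroid on $\mathbb F_q^n$. For every subspace $W\le\mathbb F_q^n$ and every positive integer $t$, the number of ordered $t$-tuples $(v_1,\dots,v_t)$ with $v_j\in\mathcal C$ for all $j$ such that $S_R(\{v_1,\dots,v_t\})=W$ equals $\chi_{\mathcal M/W^\perp}(q^{mt})$.
   Context: $\mathbb F_{q^m}$ is the degree-$m$ extension of the finite field $\mathbb F_q$, and $\Gamma$ is a fixed $\mathbb F_q$-basis of $\mathbb F_{q^m}$. For $v=(v_1,\dots,v_n)\in\mathbb F_{q^m}^n$, $\Gamma(v)$ is the $n\times m$ matrix over $\mathbb F_q$ whose $i$-th row is the coordinate vector of $v_i$ with respect to $\Gamma$. The rank support is $S_R(v)=\mathrm{colsp}_{\mathbb F_q}(\Gamma(v))\le\mathbb F_q^n$, and for a set $V$, $S_R(V)=\sum_{v\in V}S_R(v)$. An $\mathbb F_{q^m}$-linear rank metric code is an $\mathbb F_{q^m}$-subspace $\mathcal C\le\mathbb F_{q^m}^n$; let $G\in\mathbb F_{q^m}^{k\times n}$ be a matrix whose row space is $\mathcal C$. The induced $q$-matroid is $\mathcal M=(\mathbb F_q^n,\rho)$ with $\rho(V)=\mathrm{rk}_{\mathbb F_{q^m}}(G\,Y_V)$, where $Y_V$ is any matrix over $\mathbb F_q$ whose columns span $V$. Orthogonal complements $W^\perp$ are taken with respect to the standard dot product on $\mathbb F_q^n$. A $q$-matroid is a pair $(E,\rho)$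 with $\rho$ a function on subspaces satisfying $0\le\rho(V)\le\dim V$, monotonicity and submodularity. Contraction: $\mathcal M/U=(E/U,\rho')$ with $\rho'(X)=\rho(\pi^{-1}(X))-\rho(U)$, $\pi:E\to E/U$ the projection. The characteristic polynomial is $\chi_{\mathcal M}(x)=\sum_{V\le E}\mu_{\mathcal L(E)}(\{0\},V)\,x^{\rho(E)-\rho(V)}$, with $\mu_{\mathcal L(E)}$ the Möbius function of the subspace lattice of the groundspace $E$. *)

theory Defs
  imports "Jordan_Normal_Form.DL_Rank" "HOL-Algebra.AbelCoset"
begin

section \<open>Quotient spaces\<close>

abbreviation subspaces :: "('a::field, 'b, 'm) module_scheme \<Rightarrow> 'b set set" where
  "subspaces E \<equiv> {V. subspace class_ring V E}"

text \<open>The ring fields \<open>mult\<close> and \<open>one\<close> of a module record play no role for modules.\<close>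

definition quot_space ::
    "('a, 'b, 'm) module_scheme \<Rightarrow> 'b set \<Rightarrow> ('a, 'b set) module" where
  "quot_space E U =
     \<lparr>carrier = A_RCOSETS E U, mult = undefined, one = undefined,
      zero = U, add = set_add E,
      smult = (\<lambda>a X. \<Union>x\<in>X. a_r_coset E U (a \<odot>\<^bsub>E\<^esub> x))\<rparr>"

definition quot_proj ::
    "('a, 'b, 'm) module_scheme \<Rightarrow> 'b set \<Rightarrow> 'b \<Rightarrow> 'b set" where
  "quot_proj E U x = a_r_coset E U x"

lemma quot_space_vectorspace:
  assumes E: "vectorspace K E" and U: "subspace K U E"
  shows "vectorspace K (quot_space E U)"
proof -
  interpret E: vectorspace K E by fact
  interpret U: submodule K U E using E.is_module[OF U] .
  have "U \<noteq> {}" using U.zero_closed by blast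
  have Usub: "subgroup U (add_monoid E)"
    by (rule group.subgroupI[OF E.M.a_group])
      (use \<open>U \<noteq> {}\<close> U.subset U.zero_closed U.m_closed U.smult_closed[of "\<ominus>\<^bsub>K\<^esub> \<one>\<^bsub>K\<^esub>"] in
        \<open>auto simp: E.smult_l_minus a_inv_def[symmetric] subset_iff\<close>)
  interpret AU: abelian_subgroup U E
    by (rule abelian_subgroupI3) (use Usub E.M.abelian_group_axioms in \<open>auto simp: additive_subgroup_def\<close>)
  let ?Q = "quot_space E U"
  have coset: "a_r_coset E U x = {u \<oplus>\<^bsub>E\<^esub> x |u. u \<in> U}" for x
    by (auto simp: a_r_coset_def r_coset_def)
  have car: "carrier ?Q = a_r_coset E U ` carrier E"
    by (auto simp: quot_space_def A_RCOSETS_def RCOSETS_def a_r_coset_def)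
  have add: "a_r_coset E U x \<oplus>\<^bsub>?Q\<^esub> a_r_coset E U y = a_r_coset E U (x \<oplus>\<^bsub>E\<^esub> y)"
    if "x \<in> carrier E" "y \<in> carrier E" for x y
    using AU.a_rcos_sum[OF that] by (simp add: quot_space_def)
  have zero: "\<zero>\<^bsub>?Q\<^esub> = a_r_coset E U \<zero>\<^bsub>E\<^esub>"
  proof -
    have "u \<oplus>\<^bsub>E\<^esub> \<zero>\<^bsub>E\<^esub> = u" if "u \<in> U" for u
      using that U.subset by (intro E.M.r_zero) auto
    then show ?thesis by (force simp: quot_space_def coset)
  qed
  have eqI: "a_r_coset E U x = a_r_coset E U y"
    if "x \<in> a_r_coset E U y" "y \<in> carrier E" for x y
    using E.M.a_repr_independence[OF that Usub] by simp
  have smult: "a \<odot>\<^bsub>?Q\<^esub> a_r_coset E U x = a_r_coset E U (a \<odot>\<^bsub>E\<^esub> x)"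
    if "a \<in> carrier K" "x \<in> carrier E" for a x
  proof -
    have "a_r_coset E U (a \<odot>\<^bsub>E\<^esub> y) = a_r_coset E U (a \<odot>\<^bsub>E\<^esub> x)"
      if y: "y \<in> a_r_coset E U x" for y
    proof (rule eqI)
      obtain u where u: "u \<in> U" "y = u \<oplus>\<^bsub>E\<^esub> x" using y by (auto simp: coset)
      then have "a \<odot>\<^bsub>E\<^esub> y = (a \<odot>\<^bsub>E\<^esub> u) \<oplus>\<^bsub>E\<^esub> (a \<odot>\<^bsub>E\<^esub> x)"
        using U.subset \<open>a \<in> carrier K\<close> \<open>x \<in> carrier E\<close> by (auto intro!: E.smult_r_distr)
      then show "a \<odot>\<^bsub>E\<^esub> y \<in> a_r_coset E U (a \<odot>\<^bsub>E\<^esub> x)"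
        using u \<open>a \<in> carrier K\<close> by (auto simp: coset)
    qed (use \<open>a \<in> carrier K\<close> \<open>x \<in> carrier E\<close> in auto)
    moreover have "x \<in> a_r_coset E U x"
      using \<open>x \<in> carrier E\<close> U.zero_closed by (auto simp: coset intro!: exI[of _ "\<zero>\<^bsub>E\<^esub>"])
    ultimately have "(\<Union>y\<in>a_r_coset E U x. a_r_coset E U (a \<odot>\<^bsub>E\<^esub> y)) = a_r_coset E U (a \<odot>\<^bsub>E\<^esub> x)"
      by (intro SUP_eq_const) blast+
    then show ?thesis by (simp add: quot_space_def)
  qed
  show ?thesis
  proof (rule vs_criteria)
    show "field K" by (rule E.field_axioms)
    show "\<zero>\<^bsub>?Q\<^esub> \<in> carrier ?Q" by (auto simp: zero car)
    show "\<forall>v w. v \<in> carrier ?Q \<and> w \<in> carrier ?Q \<longrightarrow> v \<oplus>\<^bsub>?Q\<^esub> w \<in> carrier ?Q"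
      by (auto simp: car add)
    show "\<forall>v\<in>carrier ?Q. \<exists>w\<in>carrier ?Q. v \<oplus>\<^bsub>?Q\<^esub> w = \<zero>\<^bsub>?Q\<^esub>"
    proof
      fix v assume "v \<in> carrier ?Q"
      then obtain x where x: "x \<in> carrier E" "v = a_r_coset E U x" by (auto simp: car)
      then show "\<exists>w\<in>carrier ?Q. v \<oplus>\<^bsub>?Q\<^esub> w = \<zero>\<^bsub>?Q\<^esub>"
        by (intro bexI[of _ "a_r_coset E U (\<ominus>\<^bsub>E\<^esub> x)"]) (auto simp: car add zero E.M.r_neg)
    qed
    show "\<forall>v w. v \<in> carrier ?Q \<and> w \<in> carrier ?Q \<longrightarrow> v \<oplus>\<^bsub>?Q\<^esub> w = w \<oplus>\<^bsub>?Q\<^esub> v"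
      by (auto simp: car add E.M.a_comm)
  qed (auto simp: car add zero smult E.smult_l_distr E.smult_r_distr E.smult_assoc1 E.M.a_assoc)
qed

section \<open>The Moebius function of a finite family of sets ordered by inclusion\<close>

function moebius :: "'a set set \<Rightarrow> 'a set \<Rightarrow> 'a set \<Rightarrow> int" where
  "moebius L X Y =
     (if finite L \<and> X \<in> L \<and> Y \<in> L \<and> X \<subseteq> Y
      then if X = Y then 1 else - (\<Sum>Z\<in>{Z \<in> L. X \<subseteq> Z \<and> Z \<subset> Y}. moebius L X Z)
      else 0)"
  by pat_completeness auto
termination
proof (relation "measure (\<lambda>(L, X, Y). card {Z \<in> L. Z \<subset> Y})", goal_cases)
  case (2 L X Y Z)
  then have "{W \<in> L. W \<subset> Z} \<subset> {W \<in> L. W \<subset> Y}" by blast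
  then show ?case using 2 by (auto intro!: psubset_card_mono)
qed auto

declare moebius.simps [simp del]

section \<open>q-Matroids\<close>

record ('a, 'b) qmat =
  ground :: "('a, 'b) module"
  rk :: "'b set \<Rightarrow> nat"

definition q_matroid :: "('a::field, 'b) qmat \<Rightarrow> bool" where
  "q_matroid M \<longleftrightarrow>
     vectorspace class_ring (ground M) \<and>
     vectorspace.fin_dim class_ring (ground M) \<and>
     (\<forall>V \<in> subspaces (ground M).
        rk M V \<le> vectorspace.dim class_ring ((ground M)\<lparr>carrier := V\<rparr>)) \<and>
     (\<forall>V \<in> subspaces (ground M). \<forall>W \<in> subspaces (ground M).
        V \<subseteq> W \<longrightarrow> rk M V \<le> rk M W) \<and>
     (\<forall>V \<in> subspaces (ground M). \<forall>W \<in> subspaces (ground M).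
        rk M (module.submodule_sum (ground M) V W) + rk M (V \<inter> W) \<le> rk M V + rk M W)"

text \<open>By monotonicity of the rank function, the subtractions on \<open>nat\<close> in the following two
  definitions do not truncate.\<close>

definition contraction :: "('a, 'b) qmat \<Rightarrow> 'b set \<Rightarrow> ('a, 'b set) qmat" where
  "contraction M U =
     \<lparr>ground = quot_space (ground M) U,
      rk = (\<lambda>X. rk M {x \<in> carrier (ground M). quot_proj (ground M) U x \<in> X} - rk M U)\<rparr>"

definition characteristic_poly :: "('a::field, 'b) qmat \<Rightarrow> int poly" where
  "characteristic_poly M =
     (\<Sum>V\<in>subspaces (ground M).
        monom (moebius (subspaces (ground M)) {\<zero>\<^bsub>ground M\<^esub>} V)
              (rk M (carrier (ground M)) - rk M V))"

section \<open>Rank metric codes\<close>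

text \<open>A finite field extension is given by a field homomorphism \<open>h\<close> from the small field
  \<open>'k\<close> into the large field \<open>'l\<close>; it makes \<open>'l\<close> a vector space over \<open>'k\<close>.\<close>

definition ext_scale :: "('k::field \<Rightarrow> 'l::field) \<Rightarrow> 'k \<Rightarrow> 'l \<Rightarrow> 'l" where
  "ext_scale h a x = h a * x"

definition ext_degree :: "('k::field \<Rightarrow> 'l::field) \<Rightarrow> nat" where
  "ext_degree h = vector_space.dim (ext_scale h) UNIV"

definition ext_basis :: "('k::field \<Rightarrow> 'l::field) \<Rightarrow> 'l list \<Rightarrow> bool" where
  "ext_basis h \<Gamma> \<longleftrightarrow>
     distinct \<Gamma> \<and> \<not> module.dependent (ext_scale h) (set \<Gamma>) \<and>
     Modules.module.span (ext_scale h) (set \<Gamma>) = UNIV"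

definition coord_mat :: "('k::field \<Rightarrow> 'l::field) \<Rightarrow> 'l list \<Rightarrow> 'l vec \<Rightarrow> 'k mat" where
  "coord_mat h \<Gamma> v =
     mat (dim_vec v) (length \<Gamma>)
       (\<lambda>(i, j). module.representation (ext_scale h) (set \<Gamma>) (v $ i) (\<Gamma> ! j))"

definition rank_support :: "('k::field \<Rightarrow> 'l::field) \<Rightarrow> 'l list \<Rightarrow> 'l vec \<Rightarrow> 'k vec set" where
  "rank_support h \<Gamma> v = vec_space.col_space (dim_vec v) (coord_mat h \<Gamma> v)"

text \<open>The sum of the subspaces \<open>rank_support h \<Gamma> v\<close>, \<open>v \<in> S\<close>, of the space of vectors of
  length \<open>n\<close>.\<close>

definition rank_support_set ::
    "('k::field \<Rightarrow> 'l::field) \<Rightarrow> 'l list \<Rightarrow> nat \<Rightarrow> 'l vec set \<Rightarrow> 'k vec set" where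
  "rank_support_set h \<Gamma> n S =
     LinearCombinations.module.span class_ring (module_vec TYPE('k) n)
       (\<Union>v\<in>S. rank_support h \<Gamma> v)"

text \<open>The rank does not depend on the choice of \<open>Y\<close>; see \<open>induced_rank_eq\<close> below.\<close>

definition induced_rank :: "('k::field \<Rightarrow> 'l::field) \<Rightarrow> 'l mat \<Rightarrow> 'k vec set \<Rightarrow> nat" where
  "induced_rank h G V =
     (let Y = (SOME Y. dim_row Y = dim_col G \<and> vec_space.col_space (dim_col G) Y = V)
      in vec_space.rank (dim_row G) (G * map_mat h Y))"

definition induced_q_matroid :: "('k::field \<Rightarrow> 'l::field) \<Rightarrow> 'l mat \<Rightarrow> ('k, 'k vec) qmat" where
  "induced_q_matroid h G =
     \<lparr>ground = module_vec TYPE('k) (dim_col G), rk = induced_rank h G\<rparr>"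

section \<open>The induced rank function is well defined and satisfies the q-matroid axioms\<close>

lemma card_fin_dim:
  fixes E :: "('a::{field,finite}, 'b, 'm) module_scheme"
  assumes "vectorspace class_ring E" "vectorspace.fin_dim class_ring E"
  shows "card (carrier E) = card (UNIV :: 'a set) ^ vectorspace.dim class_ring E"
proof -
  interpret vectorspace class_ring E by fact
  obtain A where A: "finite A" "basis A" using finite_basis_exists assms(2) by blast
  then have AE: "A \<subseteq> carrier E" by (auto simp: basis_def)
  have ex1: "v \<in> carrier E \<longrightarrow> (\<exists>!a. a \<in> A \<rightarrow>\<^sub>E UNIV \<and> lincomb a A = v)" for v
    using basis_criterion[OF A(1) AE] A(2) by simp
  have cl: "lincomb a A \<in> carrier E" for a
    using AE by (intro lincomb_closed) auto
  have "bij_betw (\<lambda>a. lincomb a A) (A \<rightarrow>\<^sub>E UNIV) (carrier E)"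
    unfolding bij_betw_def inj_on_def
  proof safe
    fix a b assume "a \<in> A \<rightarrow>\<^sub>E UNIV" "b \<in> A \<rightarrow>\<^sub>E UNIV" "lincomb a A = lincomb b A"
    then show "a = b" using ex1[of "lincomb a A"] cl by metis
  next
    fix v assume "v \<in> carrier E"
    then show "v \<in> (\<lambda>a. lincomb a A) ` (A \<rightarrow>\<^sub>E UNIV)" using ex1[of v] by blast
  qed (rule cl)
  then have "card (carrier E) = card (A \<rightarrow>\<^sub>E (UNIV :: 'a set))"
    using bij_betw_same_card by metis
  then show ?thesis using A dim_basis by (simp add: card_funcsetE)
qed

context vec_space
begin

lemma vs_finite:
  assumes "finite (UNIV :: 'a set)" "subspace class_ring A V"
  shows "vectorspace class_ring (vs A)" "vectorspace.fin_dim class_ring (vs A)" "finite A"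
    "A \<subseteq> carrier_vec n" "span A = A"
proof -
  interpret A: submodule class_ring A V using assms(2) by (simp add: VectorSpace.subspace_def)
  show vs: "vectorspace class_ring (vs A)" using subspace_is_vs[OF assms(2)] .
  show sub: "A \<subseteq> carrier_vec n" using A.subset by simp
  have "finite (carrier_vec n :: 'a vec set)"
  proof -
    have "carrier_vec n \<subseteq> (\<lambda>f. vec n f) ` (PiE {..<n} (\<lambda>_. UNIV :: 'a set))"
    proof
      fix v :: "'a vec" assume "v \<in> carrier_vec n"
      then have "v = vec n (restrict (($) v) {..<n})" by (intro eq_vecI) auto
      then show "v \<in> (\<lambda>f. vec n f) ` (PiE {..<n} (\<lambda>_. UNIV))"
        by (metis UNIV_I image_eqI restrict_PiE_iff)
    qed
    then show ?thesis by (rule finite_subset) (auto intro: finite_PiE assms)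
  qed
  then show fin: "finite A" using sub finite_subset by blast
  show span: "span A = A"
    using span_is_subset[of A A] in_own_span[of A] A.submodule_axioms sub by auto
  have "LinearCombinations.module.span class_ring (vs A) A = A"
    using span_li_not_depend(1)[OF subset_refl A.submodule_axioms] span by simp
  then show "vectorspace.fin_dim class_ring (vs A)"
    unfolding vectorspace.fin_dim_def[OF vs] using fin by auto
qed

lemma exists_spanning_mat:
  assumes "finite (UNIV :: 'a set)" and A: "subspace class_ring A V"
  shows "\<exists>Y \<in> carrier_mat n (vectorspace.dim class_ring (vs A)). col_space Y = A"
proof -
  note * = vs_finite[OF assms]
  have sub: "submodule class_ring A V" using A by (simp add: VectorSpace.subspace_def)
  obtain b where b: "finite b" "vectorspace.basis class_ring (vs A) b"
    using vectorspace.finite_basis_exists[OF *(1,2)] by blast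
  obtain ys where ys: "set ys = b" "distinct ys" using finite_distinct_list[OF b(1)] by blast
  have bA: "b \<subseteq> A" and gen: "LinearCombinations.module.span class_ring (vs A) b = A"
    using b(2) vectorspace.basis_def[OF *(1)] by auto
  have "span b = A" using span_li_not_depend(1)[OF bA sub] gen by simp
  moreover have "cols (mat_of_cols n ys) = ys" using ys bA *(4) by (intro cols_mat_of_cols) auto
  moreover have "vectorspace.dim class_ring (vs A) = length ys"
    using vectorspace.dim_basis[OF *(1) b] ys distinct_card by metis
  ultimately show ?thesis
    by (intro bexI[of _ "mat_of_cols n ys"]) (auto simp: col_space_def ys)
qed

lemma card_sum_inter_le:
  assumes fin: "finite (UNIV :: 'a set)"
    and A: "subspace class_ring A V" and B: "subspace class_ring B V"
  shows "card (submodule_sum A B) * card (A \<inter> B) \<le> card A * card B"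
proof -
  interpret A: submodule class_ring A V using A by (simp add: VectorSpace.subspace_def)
  interpret B: submodule class_ring B V using B by (simp add: VectorSpace.subspace_def)
  note Af = vs_finite[OF fin A] and Bf = vs_finite[OF fin B]
  have "\<forall>s \<in> submodule_sum A B. \<exists>p. fst p \<in> A \<and> snd p \<in> B \<and> s = fst p + snd p"
    by (auto simp: submodule_sum_def)
  then obtain p where p: "\<And>s. s \<in> submodule_sum A B \<Longrightarrow>
      fst (p s) \<in> A \<and> snd (p s) \<in> B \<and> s = fst (p s) + snd (p s)"
    by metis
  let ?f = "\<lambda>(s, i). (fst (p s) + i, snd (p s) + (- 1) \<cdot>\<^sub>v i)"
  have neg: "- 1 \<cdot>\<^sub>v i \<in> B" if "i \<in> B" for i using B.smult_closed[of "- 1" i] that by simp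
  have sum: "fst (p s) + i + (snd (p s) + (- 1) \<cdot>\<^sub>v i) = s"
    if "s \<in> submodule_sum A B" "i \<in> A \<inter> B" for s i
  proof -
    have "fst (p s) \<in> carrier_vec n" "snd (p s) \<in> carrier_vec n" "i \<in> carrier_vec n"
      using p[OF that(1)] that(2) Af Bf by auto
    then have "fst (p s) + i + (snd (p s) + (- 1) \<cdot>\<^sub>v i) = fst (p s) + snd (p s)"
      by (intro eq_vecI) auto
    then show ?thesis using p[OF that(1)] by simp
  qed
  have "inj_on ?f (submodule_sum A B \<times> (A \<inter> B))"
  proof (rule inj_onI, clarify)
    fix s i s' i'
    assume s: "s \<in> submodule_sum A B" "s' \<in> submodule_sum A B"
      and i: "i \<in> A" "i \<in> B" "i' \<in> A" "i' \<in> B"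
      and e: "fst (p s) + i = fst (p s') + i'"
        "snd (p s) + - 1 \<cdot>\<^sub>v i = snd (p s') + - 1 \<cdot>\<^sub>v i'"
    have ss: "s = s'" using sum[of s i] sum[of s' i'] s i e by simp
    have "fst (p s) \<in> carrier_vec n" "i \<in> carrier_vec n" "i' \<in> carrier_vec n"
      using p[OF s(1)] i Af by auto
    then have "i = i'" using e(1) ss by (simp add: vec_eq_iff)
    then show "s = s' \<and> i = i'" using ss by simp
  qed
  moreover have "?f ` (submodule_sum A B \<times> (A \<inter> B)) \<subseteq> A \<times> B"
    using p neg A.m_closed B.m_closed by fastforce
  ultimately have "card (submodule_sum A B \<times> (A \<inter> B)) \<le> card (A \<times> B)"
    using Af(3) Bf(3) by (intro card_inj_on_le[of ?f]) auto
  then show ?thesis by (simp add: card_cartesian_product)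
qed

end


context
  fixes h :: "'k::{field,finite} \<Rightarrow> 'l::{field,finite}" and G :: "'l mat"
  assumes h: "field_hom h"
begin

interpretation h: field_hom h by (rule h)
interpretation K: vec_space "TYPE('k)" "dim_col G" .
interpretation L: vec_space "TYPE('l)" "dim_row G" .

definition ext_mult :: "'k vec \<Rightarrow> 'l vec" where "ext_mult v = G *\<^sub>v map_vec h v"

lemma ext_mult_image_carrier: "ext_mult ` S \<subseteq> carrier_vec (dim_row G)"
proof (rule image_subsetI)
  show "ext_mult v \<in> carrier_vec (dim_row G)" for v
    by (rule carrier_vecI) (simp only: ext_mult_def dim_mult_mat_vec)
qed

lemma rank_eq_dim_span:
  assumes Y: "Y \<in> carrier_mat (dim_col G) l" "K.col_space Y = A"
  shows "L.rank (G * map_mat h Y) = vectorspace.dim class_ring (L.vs (L.span (ext_mult ` A)))"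
proof -
  let ?M = "G * map_mat h Y"
  have M: "?M \<in> carrier_mat (dim_row G) l" using Y by auto
  have gvc: "ext_mult ` S \<subseteq> carrier_vec (dim_row G)" for S
    by (rule ext_mult_image_carrier)
  have cM: "set (cols ?M) \<subseteq> carrier_vec (dim_row G)" 
    using cols_dim[of ?M] by simp
  have cY: "set (cols Y) \<subseteq> A"
    using K.in_own_span[of "set (cols Y)"] Y cols_dim[of Y] by (auto simp: K.col_space_def)
  have "set (cols ?M) \<subseteq> ext_mult ` A"
  proof
    fix x assume "x \<in> set (cols ?M)"
    then obtain j where j: "j < l" "x = col ?M j" using M by (auto simp: cols_def)
    then have "x = ext_mult (col Y j)" using Y by (auto simp: ext_mult_def)
    moreover have "col Y j \<in> A" using cY j Y by (auto simp: cols_def)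
    ultimately show "x \<in> ext_mult ` A" by blast
  qed
  moreover have "ext_mult ` A \<subseteq> L.span (set (cols ?M))"
  proof (clarify)
    fix v assume "v \<in> A"
    then obtain x where x: "x \<in> carrier_vec l" "v = Y *\<^sub>v x"
      using Y K.col_space_eq[OF Y(1)] by auto
    then have "ext_mult v = ?M *\<^sub>v map_vec h x"
      using Y by (simp add: ext_mult_def h.mult_mat_vec_hom[OF Y(1)] assoc_mult_mat_vec[of _ "dim_row G" "dim_col G" _ l])
    moreover have "map_vec h x \<in> carrier_vec (dim_col ?M)" using x Y by simp
    ultimately have "ext_mult v \<in> L.col_space ?M"
      unfolding L.col_space_eq[OF M] using M by (auto intro!: bexI[of _ "map_vec h x"] carrier_vecI)
    then show "ext_mult v \<in> L.span (set (cols ?M))" by (simp add: L.col_space_def)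
  qed
  ultimately have "L.span (set (cols ?M)) = L.span (ext_mult ` A)"
    using L.span_is_monotone L.span_is_subset L.span_is_submodule[of "set (cols ?M)"] cM
    by (intro subset_antisym) auto
  then show ?thesis by (simp add: L.rank_def)
qed

lemma induced_rank_eq:
  assumes "Y \<in> carrier_mat (dim_col G) l" "vec_space.col_space (dim_col G) Y = A"
  shows "induced_rank h G A = vec_space.rank (dim_row G) (G * map_mat h Y)"
proof -
  let ?Y = "SOME Y. dim_row Y = dim_col G \<and> K.col_space Y = A"
  have "dim_row ?Y = dim_col G \<and> K.col_space ?Y = A"
    by (rule someI[of _ Y]) (use assms in auto)
  then have "?Y \<in> carrier_mat (dim_col G) (dim_col ?Y)" "K.col_space ?Y = A" by auto
  from rank_eq_dim_span[OF this] rank_eq_dim_span[OF assms] show ?thesis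
    by (simp add: induced_rank_def Let_def)
qed

lemma induced_rank_eq_dim_span:
  assumes "subspace class_ring A K.V"
  shows "induced_rank h G A = vectorspace.dim class_ring (L.vs (L.span (ext_mult ` A)))"
proof -
  obtain Y where "Y \<in> carrier_mat (dim_col G) (vectorspace.dim class_ring (K.vs A))"
      "K.col_space Y = A"
    using K.exists_spanning_mat[OF finite_UNIV assms] by (elim bexE)
  from induced_rank_eq[OF this] rank_eq_dim_span[OF this] show ?thesis by (rule trans)
qed

lemma card_span_ext_mult:
  assumes "subspace class_ring A K.V"
  shows "card (L.span (ext_mult ` A)) = card (UNIV :: 'l set) ^ induced_rank h G A"
proof -
  have "subspace class_ring (L.span (ext_mult ` A)) L.V"
    by (rule L.span_is_subspace) (simp add: ext_mult_image_carrier)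
  from L.vs_finite[OF _ this] card_fin_dim[of "L.vs (L.span (ext_mult ` A))"]
  show ?thesis by (simp add: induced_rank_eq_dim_span[OF assms])
qed

lemma induced_rank_le:
  assumes "subspace class_ring A K.V" "subspace class_ring B K.V" "A \<subseteq> B"
  shows "induced_rank h G A \<le> induced_rank h G B"
proof -
  have sub: "subspace class_ring (L.span (ext_mult ` B)) L.V"
    by (rule L.span_is_subspace) (simp add: ext_mult_image_carrier)
  have "L.span (ext_mult ` A) \<subseteq> L.span (ext_mult ` B)"
    using assms(3) by (intro L.span_is_monotone) auto
  then have "card (L.span (ext_mult ` A)) \<le> card (L.span (ext_mult ` B))"
    using L.vs_finite(3)[OF _ sub] by (intro card_mono) auto
  moreover have "1 < card (UNIV :: 'l set)"
    using card_mono[of UNIV "{0, 1 :: 'l}"] by simp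
  ultimately show ?thesis
    using card_span_ext_mult assms by (simp add: power_increasing_iff)
qed

lemma induced_q_matroid_q_matroid: "q_matroid (induced_q_matroid h G)"
proof -
  have q: "1 < card (UNIV :: 'l set)"
    using card_mono[of UNIV "{0, 1 :: 'l}"] by simp
  have le_dim: "induced_rank h G A \<le> vectorspace.dim class_ring (K.vs A)"
    if A: "subspace class_ring A K.V" for A
  proof -
    obtain Y where Y: "Y \<in> carrier_mat (dim_col G) (vectorspace.dim class_ring (K.vs A))"
        "K.col_space Y = A"
      using K.exists_spanning_mat[OF finite_UNIV A] by (elim bexE)
    have "induced_rank h G A = L.rank (G * map_mat h Y)" by (rule induced_rank_eq[OF Y])
    also have "\<dots> \<le> vectorspace.dim class_ring (K.vs A)"
      using Y by (intro L.rank_le_nc) auto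
    finally show ?thesis .
  qed
  have submod: "induced_rank h G (K.submodule_sum A B) + induced_rank h G (A \<inter> B)
      \<le> induced_rank h G A + induced_rank h G B"
    if A: "subspace class_ring A K.V" and B: "subspace class_ring B K.V" for A B
  proof -
    interpret A: submodule class_ring A K.V using A by (simp add: VectorSpace.subspace_def)
    interpret B: submodule class_ring B K.V using B by (simp add: VectorSpace.subspace_def)
    have gvc: "ext_mult ` S \<subseteq> carrier_vec (dim_row G)" for S
    by (rule ext_mult_image_carrier)
    have own: "ext_mult ` S \<subseteq> L.span (ext_mult ` S)" for S
      by (rule L.in_own_span) (use gvc in simp)
    have sub: "subspace class_ring (L.span (ext_mult ` S)) L.V" for S
      by (rule L.span_is_subspace) (use gvc in simp)
    have sum: "subspace class_ring (K.submodule_sum A B) K.V"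
      by (rule K.sum_is_subspace[OF A B])
    have int: "subspace class_ring (A \<inter> B) K.V"
      unfolding VectorSpace.subspace_def
      using A.submodule_axioms B.submodule_axioms A VectorSpace.subspace_def[of class_ring A K.V]
      by (auto simp: submodule_def)
    let ?A = "L.span (ext_mult ` A)" and ?B = "L.span (ext_mult ` B)"
    have ext_add: "ext_mult (v + w) = ext_mult v + ext_mult w"
      if "v \<in> carrier_vec (dim_col G)" "w \<in> carrier_vec (dim_col G)" for v w
    proof -
      have "map_vec h (v + w) = map_vec h v + map_vec h w"
        using that by (intro eq_vecI) (auto simp: h.hom_add)
      then show ?thesis
        using that mult_add_distrib_mat_vec[of G "dim_row G" "dim_col G" "map_vec h v" "map_vec h w"]
        by (simp add: ext_mult_def)
    qed
    have LS: "subspace class_ring (L.submodule_sum ?A ?B) L.V"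
      by (rule L.sum_is_subspace[OF sub sub])
    have "ext_mult ` K.submodule_sum A B \<subseteq> L.submodule_sum ?A ?B"
    proof clarify
      fix x assume "x \<in> K.submodule_sum A B"
      then obtain v w where vw: "v \<in> A" "w \<in> B" "x = v + w"
        by (auto simp: K.submodule_sum_def)
      then have "ext_mult x = ext_mult v + ext_mult w" using ext_add A.subset B.subset by auto
      moreover have "ext_mult v \<in> ?A" "ext_mult w \<in> ?B"
        using vw by (simp_all only: subsetD[OF own imageI])
      ultimately show "ext_mult x \<in> L.submodule_sum ?A ?B"
        unfolding L.submodule_sum_def by (intro image_eqI[of _ _ "(ext_mult v, ext_mult w)"]) simp_all
    qed
    then have "L.span (ext_mult ` K.submodule_sum A B) \<subseteq> L.submodule_sum ?A ?B"
      using LS by (intro L.span_is_subset) (auto simp: VectorSpace.subspace_def)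
    then have c1: "card (L.span (ext_mult ` K.submodule_sum A B)) \<le> card (L.submodule_sum ?A ?B)"
      using L.vs_finite(3)[OF _ LS] by (intro card_mono) auto
    have "L.span (ext_mult ` (A \<inter> B)) \<subseteq> ?A \<inter> ?B"
      by (intro Int_greatest L.span_is_monotone) auto
    then have c2: "card (L.span (ext_mult ` (A \<inter> B))) \<le> card (?A \<inter> ?B)"
      using L.vs_finite(3)[OF _ sub[of A]] by (intro card_mono) auto
    have "card (L.span (ext_mult ` K.submodule_sum A B)) * card (L.span (ext_mult ` (A \<inter> B)))
        \<le> card ?A * card ?B"
      using mult_le_mono[OF c1 c2] L.card_sum_inter_le[OF _ sub sub, of A B] by simp
    then show ?thesis
      using q by (simp add: card_span_ext_mult A B sum int power_add[symmetric])
  qed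
  show ?thesis
    using le_dim induced_rank_le submod K.vectorspace_axioms K.fin_dim
    by (simp add: q_matroid_def induced_q_matroid_def)
qed

end

end

theory Submission
  imports Defs
begin

text \<open>Let \<open>Q = q ^ m\<close>. A vector \<open>x\<close> over the small field is orthogonal to the rank support of
  a codeword \<open>v\<close> iff \<open>v \<bullet> map_vec h x = 0\<close>; so a tuple has rank support \<open>W\<close> iff its annihilator
  in this sense is \<open>U\<close>, the orthogonal complement of \<open>W\<close>. Writing codewords as \<open>G\<^sup>T *\<^sub>v x\<close>, the
  codewords annihilating \<open>V\<close> come from the \<open>x\<close> orthogonal to the span of \<open>G *\<^sub>v map_vec h y\<close>,
  \<open>y \<in> V\<close>, and counting gives \<open>Q ^ (\<rho>(E) - \<rho>(V))\<close> of them. Moebius inversion over the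
  subspaces \<open>V\<close> above \<open>U\<close>, i.e. over the subspaces of the ground space of the contraction, turns
  the numbers \<open>Q ^ (t * (\<rho>(E) - \<rho>(V)))\<close> of tuples annihilating \<open>V\<close> into the number of tuples with
  annihilator exactly \<open>U\<close>.\<close>

section \<open>Orthogonal complements over finite fields\<close>

text \<open>\<open>subspace\<close> bundles module and vector space axioms that
  \<open>module_vec\<close> always satisfies; only the closure conditions carry information.\<close>

lemma subspace_vec_iff:
  fixes S :: "'a::field vec set"
  shows "subspace class_ring S (module_vec TYPE('a) n) \<longleftrightarrow>
    S \<subseteq> carrier_vec n \<and> 0\<^sub>v n \<in> S \<and> (\<forall>x\<in>S. \<forall>y\<in>S. x + y \<in> S) \<and> (\<forall>c. \<forall>x\<in>S. c \<cdot>\<^sub>v x \<in> S)"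
  using vec_vs[where 'a='a and n=n] vec_module[where 'a='a and n=n]
  by (auto simp: VectorSpace.subspace_def submodule_def module_vec_simps class_ring_simps)

lemma card_carrier_vec:
  "card (carrier_vec n :: 'a::{field,finite} vec set) = card (UNIV :: 'a set) ^ n"
proof -
  interpret vec_space "TYPE('a)" n .
  show ?thesis using card_fin_dim[OF vec_vs, where 'a='a and ?n1=n] fin_dim dim_is_n by simp
qed

text \<open>An infinite set has \<open>card\<close> 0, so the positive cardinality forces
  finiteness.\<close>

lemma finite_carrier_vec: "finite (carrier_vec n :: 'a::{field,finite} vec set)"
  by (rule card_ge_0_finite) (simp add: card_carrier_vec finite_UNIV_card_ge_0)

text \<open>The fibre of \<open>f\<close> through \<open>y\<close> is the translate of
  \<open>N\<close> by \<open>y\<close>, so all fibres have \<open>card N\<close> elements. The type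
  of the values is left free: \<open>f\<close> will be a scalar product in one use and a matrix
  product in another.\<close>

lemma card_kernel_times_image:
  fixes f :: "'a::field vec \<Rightarrow> 'b"
  assumes fin: "finite S" and S: "S \<subseteq> carrier_vec n"
    and add: "\<And>x y. x \<in> S \<Longrightarrow> y \<in> S \<Longrightarrow> x + y \<in> S"
    and N: "N \<subseteq> S" "\<And>x y. x \<in> S \<Longrightarrow> y \<in> S \<Longrightarrow> f x = f y \<longleftrightarrow> x - y \<in> N"
  shows "card S = card N * card (f ` S)"
proof -
  have "card {x \<in> S. f x = b} = card N" if "b \<in> f ` S" for b
  proof -
    obtain y where y: "y \<in> S" "b = f y" using \<open>b \<in> f ` S\<close> by blast
    have eq: "y + x - y = x" "y + (x - y) = x" if "x \<in> S" for x
    proof -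
      have "x \<in> carrier_vec n" "y \<in> carrier_vec n" using that y S by auto
      then show "y + x - y = x" "y + (x - y) = x" by (auto intro!: eq_vecI)
    qed
    have "{x \<in> S. f x = b} = (\<lambda>x. y + x) ` N"
    proof (intro equalityI subsetI)
      fix x assume "x \<in> {x \<in> S. f x = b}"
      then show "x \<in> (\<lambda>x. y + x) ` N" using y N eq(2)[of x]
        by (intro image_eqI[of _ _ "x - y"]) auto
    next
      fix x assume "x \<in> (\<lambda>x. y + x) ` N"
      then show "x \<in> {x \<in> S. f x = b}" using y N eq(1) add by fastforce
    qed
    moreover have "inj_on (\<lambda>x. y + x) N"
      using eq(1) N(1) by (intro inj_on_inverseI[of _ "\<lambda>x. x - y"]) auto
    ultimately show ?thesis by (simp add: card_image)
  qed
  then have "(\<Sum>b\<in>f ` S. card {x \<in> S. f x = b}) = card N * card (f ` S)" by simp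
  then show ?thesis using sum.image_gen[OF fin, of "\<lambda>_. 1::nat" f] by simp
qed

lemma subspace_vec_minus:
  fixes S :: "'a::field vec set"
  assumes "subspace class_ring S (module_vec TYPE('a) n)" "x \<in> S" "y \<in> S"
  shows "x - y \<in> S"
proof -
  have "x \<in> carrier_vec n" "y \<in> carrier_vec n" "x + (- 1) \<cdot>\<^sub>v y \<in> S"
    using assms by (auto simp: subspace_vec_iff)
  moreover from this have "x + (- 1) \<cdot>\<^sub>v y = x - y" by (intro eq_vecI) auto
  ultimately show ?thesis by simp
qed

lemma subspace_orthogonal_complement:
  fixes S :: "'a::field vec set"
  assumes "S \<subseteq> carrier_vec n"
  shows "subspace class_ring (vec_module.orthogonal_complement n S) (module_vec TYPE('a) n)"
  using assms by (auto simp: subspace_vec_iff vec_module.orthogonal_complement_def subset_iff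
    add_scalar_prod_distrib[of _ n])

lemma subspace_vec_finite:
  fixes S :: "'a::{field,finite} vec set"
  assumes "subspace class_ring S (module_vec TYPE('a) n)"
  shows "finite S"
  using assms finite_carrier_vec finite_subset by (auto simp: subspace_vec_iff)

text \<open>A functional that is nonzero on \<open>S\<close> takes every value, by scaling one
  vector, and its fibres are the translates of its kernel.\<close>

lemma card_orthogonal_to_vec:
  fixes S :: "'a::{field,finite} vec set"
  assumes S: "subspace class_ring S (module_vec TYPE('a) n)" and y: "y \<in> carrier_vec n"
    and ne: "\<exists>x\<in>S. x \<bullet> y \<noteq> 0"
  shows "card S = card {x \<in> S. x \<bullet> y = 0} * card (UNIV :: 'a set)"
proof -
  have SD: "S \<subseteq> carrier_vec n" "\<And>x y. x \<in> S \<Longrightarrow> y \<in> S \<Longrightarrow> x + y \<in> S"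
    "\<And>c x. x \<in> S \<Longrightarrow> c \<cdot>\<^sub>v x \<in> S"
    using S by (auto simp: subspace_vec_iff)
  have minus: "(u - v) \<bullet> y = u \<bullet> y - v \<bullet> y" if "u \<in> S" "v \<in> S" for u v
    using that SD(1) y by (intro minus_scalar_prod_distrib) auto
  obtain x where x: "x \<in> S" "x \<bullet> y \<noteq> 0" using ne by blast
  have "c \<in> (\<lambda>x. x \<bullet> y) ` S" for c
  proof (rule image_eqI)
    show "c = ((c / (x \<bullet> y)) \<cdot>\<^sub>v x) \<bullet> y" using x y SD(1) by (subst smult_scalar_prod_distrib) auto
    show "(c / (x \<bullet> y)) \<cdot>\<^sub>v x \<in> S" using x SD by auto
  qed
  then have "(\<lambda>x. x \<bullet> y) ` S = UNIV" by auto
  then show ?thesis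
    using card_kernel_times_image[OF subspace_vec_finite[OF S] SD(1,2),
        of "{x \<in> S. x \<bullet> y = 0}" "\<lambda>x. x \<bullet> y"] subspace_vec_minus[OF S] minus
    by auto
qed

lemma card_field_gt_1: "1 < card (UNIV :: 'a::{field,finite} set)"
  using card_mono[of UNIV "{0, 1 :: 'a}"] by simp

text \<open>Double counting of the pairs \<open>(x, y)\<close> with \<open>y \<in> S\<close> and \<open>x \<bullet> y = 0\<close>.\<close>
lemma card_orthogonal_complement:
  fixes S :: "'a::{field,finite} vec set"
  assumes S: "subspace class_ring S (module_vec TYPE('a) n)"
  shows "card S * card (vec_module.orthogonal_complement n S) = card (UNIV :: 'a set) ^ n"
proof -
  let ?V = "carrier_vec n :: 'a vec set" and ?q = "card (UNIV :: 'a set)"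
  let ?O = "vec_module.orthogonal_complement n S"
  have SV: "S \<subseteq> ?V" and S0: "0\<^sub>v n \<in> S" using S by (auto simp: subspace_vec_iff)
  have V: "subspace class_ring ?V (module_vec TYPE('a) n)" by (auto simp: subspace_vec_iff)
  note finS = subspace_vec_finite[OF S] and finV = finite_carrier_vec[where 'a='a and n=n]
  have OV: "?O \<subseteq> ?V" by (auto simp: vec_module.orthogonal_complement_def)
  \<comment> \<open>The factor \<open>?q\<close> avoids dividing the size of the whole space by
    \<open>?q\<close> to get that of a hyperplane.\<close>
  have col: "?q * card {x \<in> ?V. x \<bullet> y = 0} = (if y = 0\<^sub>v n then ?q * card ?V else card ?V)"
    if "y \<in> S" for y
  proof (cases "y = 0\<^sub>v n")
    case True
    then show ?thesis by (simp add: Collect_conj_eq[symmetric] cong: conj_cong)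
  next
    case False
    have y: "y \<in> ?V" using that SV by auto
    then obtain i where "i < n" "y $ i \<noteq> 0" using False by (auto simp: vec_eq_iff)
    then have "\<exists>x\<in>?V. x \<bullet> y \<noteq> 0" using y by (intro bexI[of _ "unit_vec n i"]) auto
    from card_orthogonal_to_vec[OF V y this] False show ?thesis by simp
  qed
  have row: "?q * card {y \<in> S. x \<bullet> y = 0} = (if x \<in> ?O then ?q * card S else card S)"
    if x: "x \<in> ?V" for x
  proof -
    have comm: "x \<bullet> y = y \<bullet> x" if "y \<in> S" for y using that SV x by (intro comm_scalar_prod) auto
    show ?thesis
    proof (cases "x \<in> ?O")
      case True
      then have "{y \<in> S. x \<bullet> y = 0} = S" by (auto simp: vec_module.orthogonal_complement_def)
      then show ?thesis using True by simp
    next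
      case False
      then have "\<exists>y\<in>S. y \<bullet> x \<noteq> 0"
        using x comm by (auto simp: vec_module.orthogonal_complement_def)
      from card_orthogonal_to_vec[OF S x this] False comm show ?thesis by (simp cong: conj_cong)
    qed
  qed
  have "(\<Sum>x\<in>?V. card {y \<in> S. x \<bullet> y = 0}) = (\<Sum>y\<in>S. card {x \<in> ?V. x \<bullet> y = 0})"
    using sum.swap_restrict[OF finV finS, of "\<lambda>_ _. 1 :: nat" "\<lambda>x y. x \<bullet> y = 0"] by simp
  then have "(\<Sum>x\<in>?V. ?q * card {y \<in> S. x \<bullet> y = 0}) = (\<Sum>y\<in>S. ?q * card {x \<in> ?V. x \<bullet> y = 0})"
    by (simp add: sum_distrib_left[symmetric])
  then have "(\<Sum>x\<in>?V. if x \<in> ?O then ?q * card S else card S)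
      = (\<Sum>y\<in>S. if y = 0\<^sub>v n then ?q * card ?V else card ?V)"
    using row col by simp
  moreover have "(\<Sum>x\<in>?V. if x \<in> ?O then ?q * card S else card S)
      = card ?O * (?q * card S) + (card ?V - card ?O) * card S"
  proof -
    have "?V \<inter> ?O = ?O" using OV by blast
    moreover have "card (?V \<inter> - ?O) = card ?V - card ?O"
      using card_Diff_subset[OF finite_subset[OF OV finV] OV] by (simp add: Diff_eq)
    ultimately show ?thesis using finV by (simp add: sum.If_cases)
  qed
  moreover have "(\<Sum>y\<in>S. if y = 0\<^sub>v n then ?q * card ?V else card ?V)
      = ?q * card ?V + (card S - 1) * card ?V"
    using finS S0 by (simp add: sum.remove[of S "0\<^sub>v n"] card_Diff_singleton)
  ultimately have "card ?O * (?q * card S) + (card ?V - card ?O) * card S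
      = ?q * card ?V + (card S - 1) * card ?V" by simp
  moreover have "card ?O \<le> card ?V" using OV finV by (rule card_mono[rotated])
  moreover have "1 \<le> card S" using S0 finS by (metis One_nat_def Suc_leI card_gt_0_iff empty_iff)
  \<comment> \<open>Over the integers the product \<open>card ?V * card S\<close> cancels and the
    nonzero factor \<open>?q - 1\<close> can be split off.\<close>
  ultimately have "int (card ?O) * (int ?q * int (card S)) + (int (card ?V) - int (card ?O)) * int (card S)
      = int ?q * int (card ?V) + (int (card S) - 1) * int (card ?V)"
    by (metis (no_types, lifting) of_nat_1 of_nat_add of_nat_diff of_nat_mult)
  then have "(int ?q - 1) * (int (card S) * int (card ?O)) = (int ?q - 1) * int (card ?V)"
    by (simp add: algebra_simps)
  then have "int (card S) * int (card ?O) = int (card ?V)"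
    using card_field_gt_1[where 'a='a] by simp
  then show ?thesis by (simp add: card_carrier_vec flip: of_nat_mult)
qed

text \<open>One inclusion is direct. The product formula for \<open>S\<close> and for its complement
  shows that both sides have the same finite cardinality.\<close>

lemma orthogonal_complement_orthogonal_complement:
  fixes S :: "'a::{field,finite} vec set"
  assumes S: "subspace class_ring S (module_vec TYPE('a) n)"
  shows "vec_module.orthogonal_complement n (vec_module.orthogonal_complement n S) = S"
proof -
  let ?O = "vec_module.orthogonal_complement n S"
  have SV: "S \<subseteq> carrier_vec n" using S by (auto simp: subspace_vec_iff)
  have O: "subspace class_ring ?O (module_vec TYPE('a) n)"
    using SV by (rule subspace_orthogonal_complement)
  then have OO: "subspace class_ring (vec_module.orthogonal_complement n ?O) (module_vec TYPE('a) n)"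
    by (intro subspace_orthogonal_complement) (auto simp: subspace_vec_iff)
  have "S \<subseteq> vec_module.orthogonal_complement n ?O"
  proof
    fix x assume x: "x \<in> S"
    have "x \<bullet> y = 0" if "y \<in> ?O" for y
      using that x SV comm_scalar_prod[of x n y] by (auto simp: vec_module.orthogonal_complement_def)
    then show "x \<in> vec_module.orthogonal_complement n ?O"
      using x SV by (auto simp: vec_module.orthogonal_complement_def)
  qed
  moreover have "card (vec_module.orthogonal_complement n ?O) = card S"
  proof -
    have "card S * card ?O = card ?O * card (vec_module.orthogonal_complement n ?O)"
      using card_orthogonal_complement[OF S] card_orthogonal_complement[OF O] by simp
    moreover have "card ?O > 0"
      using card_orthogonal_complement[OF S] card_field_gt_1[where 'a='a]
      by (metis gr0I less_zeroE mult_0_right power_eq_0_iff)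
    ultimately show ?thesis by simp
  qed
  ultimately show ?thesis 
    using card_subset_eq[OF subspace_vec_finite[OF OO]] by metis
qed

section \<open>Moebius inversion over the subspaces of a quotient space\<close>

text \<open>For \<open>X \<noteq> Y\<close>, the recursion makes the value at \<open>Y\<close> minus
  the sum over the smaller \<open>Z\<close>, so the top term cancels the rest.\<close>

lemma sum_moebius:
  assumes L: "finite L" and X: "X \<in> L" and Y: "Y \<in> L" "X \<subseteq> Y"
  shows "(\<Sum>Z | Z \<in> L \<and> X \<subseteq> Z \<and> Z \<subseteq> Y. moebius L X Z) = (if X = Y then 1 else 0)"
proof (cases "X = Y")
  case True
  then have "{Z. Z \<in> L \<and> X \<subseteq> Z \<and> Z \<subseteq> Y} = {Y}" using X by auto
  then show ?thesis using True L X by (simp add: moebius.simps)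
next
  case False
  have "{Z. Z \<in> L \<and> X \<subseteq> Z \<and> Z \<subseteq> Y} = insert Y {Z \<in> L. X \<subseteq> Z \<and> Z \<subset> Y}" using Y by auto
  then show ?thesis using False L X Y by (simp add: moebius.simps[of L X Y])
qed

section \<open>Subspaces of the quotient and subspaces containing \<open>U\<close>\<close>

context
  fixes K :: "('a, 'c) ring_scheme" and E :: "('a, 'b, 'm) module_scheme" and U :: "'b set"
  assumes U: "subspace K U E"
begin

interpretation E: vectorspace K E using U by (simp add: VectorSpace.subspace_def)
interpretation U: submodule K U E using E.is_module[OF U] .

text \<open>Negation is scaling by minus one. The subgroup property opens the theory of
  cosets.\<close>

lemma subgroup_subspace: "subgroup U (add_monoid E)"
  using U.subset U.m_closed U.zero_closed U.smult_closed[of "\<ominus>\<^bsub>K\<^esub> \<one>\<^bsub>K\<^esub>"]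
  by (intro group.subgroupI[OF E.M.a_group])
    (auto simp: E.smult_l_minus a_inv_def[symmetric] subset_iff simp del: U.zero_closed)

interpretation AU: abelian_subgroup U E
  by (rule abelian_subgroupI3)
    (use subgroup_subspace E.M.abelian_group_axioms in \<open>auto simp: additive_subgroup_def\<close>)

lemma mem_quot_proj: "y \<in> quot_proj E U x \<longleftrightarrow> (\<exists>u\<in>U. y = u \<oplus>\<^bsub>E\<^esub> x)"
  by (auto simp: quot_proj_def a_r_coset_def r_coset_def)

lemma quot_proj_self: "x \<in> carrier E \<Longrightarrow> x \<in> quot_proj E U x"
  unfolding mem_quot_proj using U.zero_closed by (intro bexI[of _ "\<zero>\<^bsub>E\<^esub>"]) auto

lemma quot_proj_eqI: "x \<in> quot_proj E U y \<Longrightarrow> y \<in> carrier E \<Longrightarrow> quot_proj E U x = quot_proj E U y"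
  unfolding quot_proj_def using E.M.a_repr_independence[OF _ _ subgroup_subspace] by metis

lemma quot_proj_mem: "u \<in> U \<Longrightarrow> quot_proj E U u = U"
  unfolding quot_proj_def using AU.a_rcos_const by simp

lemma carrier_quot_space: "carrier (quot_space E U) = quot_proj E U ` carrier E"
  by (auto simp: quot_space_def quot_proj_def A_RCOSETS_def RCOSETS_def a_r_coset_def)

lemma add_quot_space:
  "x \<in> carrier E \<Longrightarrow> y \<in> carrier E \<Longrightarrow>
    quot_proj E U x \<oplus>\<^bsub>quot_space E U\<^esub> quot_proj E U y = quot_proj E U (x \<oplus>\<^bsub>E\<^esub> y)"
  using AU.a_rcos_sum by (simp add: quot_space_def quot_proj_def)

lemma zero_quot_space: "\<zero>\<^bsub>quot_space E U\<^esub> = U"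
  by (simp add: quot_space_def)

text \<open>\<open>quot_space\<close> takes a union over all representatives; they all yield the
  same coset, as \<open>U\<close> is closed under scaling, so the union collapses.\<close>

lemma smult_quot_space:
  assumes "a \<in> carrier K" "x \<in> carrier E"
  shows "a \<odot>\<^bsub>quot_space E U\<^esub> quot_proj E U x = quot_proj E U (a \<odot>\<^bsub>E\<^esub> x)"
proof -
  have "quot_proj E U (a \<odot>\<^bsub>E\<^esub> y) = quot_proj E U (a \<odot>\<^bsub>E\<^esub> x)" if "y \<in> quot_proj E U x" for y
  proof (rule quot_proj_eqI)
    obtain u where u: "u \<in> U" "y = u \<oplus>\<^bsub>E\<^esub> x"
      using \<open>y \<in> quot_proj E U x\<close> by (auto simp: mem_quot_proj)
    then have "a \<odot>\<^bsub>E\<^esub> y = (a \<odot>\<^bsub>E\<^esub> u) \<oplus>\<^bsub>E\<^esub> (a \<odot>\<^bsub>E\<^esub> x)"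
      using U.subset assms by (auto intro!: E.smult_r_distr)
    then show "a \<odot>\<^bsub>E\<^esub> y \<in> quot_proj E U (a \<odot>\<^bsub>E\<^esub> x)"
      using u assms by (auto simp: mem_quot_proj)
  qed (use assms in auto)
  then have "(\<Union>y\<in>quot_proj E U x. quot_proj E U (a \<odot>\<^bsub>E\<^esub> y)) = quot_proj E U (a \<odot>\<^bsub>E\<^esub> x)"
    using quot_proj_self[OF assms(2)] by (intro SUP_eq_const) blast+
  then show ?thesis by (simp add: quot_space_def quot_proj_def)
qed

text \<open>The zero of the quotient is \<open>U\<close> itself, so \<open>U\<close> is a member of
  \<open>X\<close> and every element of \<open>U\<close> projects to it.\<close>

lemma subspace_quot_proj_vimage:
  assumes X: "subspace K X (quot_space E U)"
  shows "subspace K {x \<in> carrier E. quot_proj E U x \<in> X} E"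
    and "U \<subseteq> {x \<in> carrier E. quot_proj E U x \<in> X}"
proof -
  interpret X: submodule K X "quot_space E U" using X by (simp add: VectorSpace.subspace_def)
  have UX: "U \<in> X" using X.zero_closed by (simp add: zero_quot_space)
  then show sub: "U \<subseteq> {x \<in> carrier E. quot_proj E U x \<in> X}"
    using U.subset by (auto simp: quot_proj_mem)
  have "quot_proj E U (v \<oplus>\<^bsub>E\<^esub> w) \<in> X"
    if "v \<in> carrier E" "quot_proj E U v \<in> X" "w \<in> carrier E" "quot_proj E U w \<in> X" for v w
    using X.m_closed[of "quot_proj E U v" "quot_proj E U w"] that by (simp add: add_quot_space)
  moreover have "quot_proj E U (c \<odot>\<^bsub>E\<^esub> v) \<in> X"
    if "c \<in> carrier K" "v \<in> carrier E" "quot_proj E U v \<in> X" for c v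
    using X.smult_closed[of c "quot_proj E U v"] that by (simp add: smult_quot_space)
  moreover have "quot_proj E U \<zero>\<^bsub>E\<^esub> \<in> X"
    using UX by (simp add: quot_proj_mem[OF U.zero_closed])
  ultimately show "subspace K {x \<in> carrier E. quot_proj E U x \<in> X} E"
    unfolding VectorSpace.subspace_def submodule_def
    using E.module_axioms E.vectorspace_axioms by auto
qed

lemma subspace_quot_proj_image:
  assumes S: "subspace K S E"
  shows "subspace K (quot_proj E U ` S) (quot_space E U)"
proof -
  interpret S: submodule K S E using S by (simp add: VectorSpace.subspace_def)
  have Q: "vectorspace K (quot_space E U)"
    by (rule quot_space_vectorspace[OF E.vectorspace_axioms U])
  interpret Q: vectorspace K "quot_space E U" by fact
  have "\<zero>\<^bsub>quot_space E U\<^esub> \<in> quot_proj E U ` S"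
    using S.zero_closed quot_proj_mem[OF U.zero_closed] by (force simp: zero_quot_space)
  moreover have "v \<in> carrier E" if "v \<in> S" for v using that S.subset by auto
  ultimately show ?thesis
    unfolding VectorSpace.subspace_def submodule_def
    using Q Q.module_axioms
    by (auto simp: carrier_quot_space add_quot_space smult_quot_space
      intro!: imageI S.m_closed S.smult_closed)
qed

text \<open>A subspace containing \<open>U\<close> is a union of cosets. The adjunction turns a
  condition on preimages in \<open>E\<close> into an upper bound in the lattice of the
  quotient.\<close>

lemma quot_proj_vimage_subset_iff:
  assumes S: "subspace K S E" "U \<subseteq> S" and X: "X \<subseteq> carrier (quot_space E U)"
  shows "{x \<in> carrier E. quot_proj E U x \<in> X} \<subseteq> S \<longleftrightarrow> X \<subseteq> quot_proj E U ` S"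
proof -
  interpret S: submodule K S E using S(1) by (simp add: VectorSpace.subspace_def)
  show ?thesis
  proof (intro iffI subsetI)
    fix c assume sub: "{x \<in> carrier E. quot_proj E U x \<in> X} \<subseteq> S" and c: "c \<in> X"
    then obtain x where "x \<in> carrier E" "c = quot_proj E U x" using X by (auto simp: carrier_quot_space)
    then show "c \<in> quot_proj E U ` S" using sub c by blast
  next
    fix x assume sub: "X \<subseteq> quot_proj E U ` S" and x: "x \<in> {x \<in> carrier E. quot_proj E U x \<in> X}"
    then obtain y where y: "y \<in> S" "quot_proj E U x = quot_proj E U y" by blast
    then obtain u where "u \<in> U" "x = u \<oplus>\<^bsub>E\<^esub> y"
      using quot_proj_self[of x] x by (auto simp: mem_quot_proj)
    then show "x \<in> S" using y S(2) S.m_closed by auto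
  qed
qed

text \<open>Decides when the interval from the zero subspace to the image of \<open>S\<close> is a
  single point, the only case of a nonzero Moebius sum.\<close>

lemma quot_proj_image_eq_zero_iff:
  assumes S: "subspace K S E" "U \<subseteq> S"
  shows "{\<zero>\<^bsub>quot_space E U\<^esub>} = quot_proj E U ` S \<longleftrightarrow> S = U"
proof -
  interpret S: submodule K S E using S(1) by (simp add: VectorSpace.subspace_def)
  show ?thesis
  proof
    assume "{\<zero>\<^bsub>quot_space E U\<^esub>} = quot_proj E U ` S"
    then have "quot_proj E U x = U" if "x \<in> S" for x using that by (auto simp: zero_quot_space)
    moreover have "x \<in> quot_proj E U x" if "x \<in> S" for x using that S.subset quot_proj_self by auto
    ultimately show "S = U" using S(2) by auto
  next
    assume "S = U"
    then have "quot_proj E U ` S = (\<lambda>_. U) ` U" using quot_proj_mem by (intro image_cong) auto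
    then show "{\<zero>\<^bsub>quot_space E U\<^esub>} = quot_proj E U ` S"
      using U.zero_closed by (simp add: zero_quot_space image_constant)
  qed
qed

end

text \<open>Exchanging the sums, each \<open>x\<close> contributes the Moebius values of those
  \<open>X\<close> whose preimage lies in \<open>S x\<close>. If \<open>S x\<close> contains
  \<open>U\<close>, these \<open>X\<close> form the interval from zero to the image of
  \<open>S x\<close>; otherwise there are none, because every preimage contains
  \<open>U\<close>.\<close>

lemma sum_moebius_quot_space:
  fixes E :: "('a::field, 'b, 'm) module_scheme"
  assumes U: "subspace class_ring U E" and E: "finite (carrier E)" and T: "finite T"
    and S: "\<And>x. x \<in> T \<Longrightarrow> subspace class_ring (S x) E"
  shows "(\<Sum>X\<in>subspaces (quot_space E U).
      moebius (subspaces (quot_space E U)) {\<zero>\<^bsub>quot_space E U\<^esub>} X *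
        int (card {x \<in> T. {y \<in> carrier E. quot_proj E U y \<in> X} \<subseteq> S x}))
    = int (card {x \<in> T. S x = U})"
proof -
  let ?Q = "quot_space E U" and ?L = "subspaces (quot_space E U)"
  let ?\<mu> = "moebius ?L {\<zero>\<^bsub>?Q\<^esub>}" and ?pre = "\<lambda>X. {y \<in> carrier E. quot_proj E U y \<in> X}"
  have sub: "X \<subseteq> carrier ?Q" "\<zero>\<^bsub>?Q\<^esub> \<in> X" if "X \<in> ?L" for X
    using that by (auto simp: VectorSpace.subspace_def submodule_def)
  have "finite (carrier ?Q)" using E by (simp add: carrier_quot_space[OF U])
  then have fin: "finite ?L" using sub(1) by (intro finite_subset[of ?L "Pow (carrier ?Q)"]) blast+
  have "quot_proj E U ` U = {\<zero>\<^bsub>?Q\<^esub>}" using quot_proj_image_eq_zero_iff[OF U U] by simp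
  then have zero: "{\<zero>\<^bsub>?Q\<^esub>} \<in> ?L" using subspace_quot_proj_image[OF U U] by simp
  have "(\<Sum>X | X \<in> ?L \<and> ?pre X \<subseteq> S x. ?\<mu> X) = (if S x = U then 1 else 0)" if x: "x \<in> T" for x
  proof (cases "U \<subseteq> S x")
    case True
    have "{X. X \<in> ?L \<and> ?pre X \<subseteq> S x} = {X. X \<in> ?L \<and> {\<zero>\<^bsub>?Q\<^esub>} \<subseteq> X \<and> X \<subseteq> quot_proj E U ` S x}"
    proof (rule Collect_cong, rule conj_cong[OF refl])
      fix X assume "X \<in> ?L"
      then show "?pre X \<subseteq> S x \<longleftrightarrow> {\<zero>\<^bsub>?Q\<^esub>} \<subseteq> X \<and> X \<subseteq> quot_proj E U ` S x"
        using sub[of X] quot_proj_vimage_subset_iff[OF U S[OF x] True, of X] by simp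
    qed
    then have "(\<Sum>X | X \<in> ?L \<and> ?pre X \<subseteq> S x. ?\<mu> X)
        = (\<Sum>X | X \<in> ?L \<and> {\<zero>\<^bsub>?Q\<^esub>} \<subseteq> X \<and> X \<subseteq> quot_proj E U ` S x. ?\<mu> X)"
      by (rule arg_cong)
    also have "\<dots> = (if {\<zero>\<^bsub>?Q\<^esub>} = quot_proj E U ` S x then 1 else 0)"
      using subspace_quot_proj_image[OF U S[OF x]] sub(2)[of "quot_proj E U ` S x"]
      by (intro sum_moebius fin zero) auto
    also have "\<dots> = (if S x = U then 1 else 0)"
      by (simp only: quot_proj_image_eq_zero_iff[OF U S[OF x] True])
    finally show ?thesis .
  next
    case False
    have "\<not> (X \<in> ?L \<and> ?pre X \<subseteq> S x)" for X
    proof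
      assume "X \<in> ?L \<and> ?pre X \<subseteq> S x"
      then have X: "subspace class_ring X ?Q" and sub: "?pre X \<subseteq> S x" by blast+
      have "U \<subseteq> S x" using subspace_quot_proj_vimage(2)[OF U X] sub by (rule order_trans)
      then show False using False by contradiction
    qed
    then have "{X. X \<in> ?L \<and> ?pre X \<subseteq> S x} = {}" by (simp only: Collect_empty_eq simp_thms)
    moreover have "S x \<noteq> U" using False by auto
    ultimately show ?thesis by (simp only: sum.empty if_False)
  qed
  then have "(\<Sum>x\<in>T. \<Sum>X | X \<in> ?L \<and> ?pre X \<subseteq> S x. ?\<mu> X) = (\<Sum>x\<in>T. if S x = U then 1 else 0)"
    by (rule sum.cong[OF refl])
  also have "\<dots> = int (card {x \<in> T. S x = U})"
    using sum.inter_filter[OF T, of "\<lambda>_. 1 :: int" "\<lambda>x. S x = U"] by simp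
  finally have "int (card {x \<in> T. S x = U}) = (\<Sum>x\<in>T. \<Sum>X | X \<in> ?L \<and> ?pre X \<subseteq> S x. ?\<mu> X)"
    by (rule sym)
  also have "\<dots> = (\<Sum>X\<in>?L. \<Sum>x | x \<in> T \<and> ?pre X \<subseteq> S x. ?\<mu> X)"
    by (rule sum.swap_restrict[OF T fin])
  also have "\<dots> = (\<Sum>X\<in>?L. ?\<mu> X * int (card {x \<in> T. ?pre X \<subseteq> S x}))"
    by (simp only: sum_constant mult.commute)
  finally show ?thesis by (rule sym)
qed

section \<open>Rank supports and codewords\<close>

lemma vector_space_ext_scale:
  assumes "field_hom h"
  shows "vector_space (ext_scale h)"
proof -
  interpret field_hom h by fact
  show ?thesis by unfold_locales (auto simp: ext_scale_def algebra_simps hom_add hom_mult)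
qed

text \<open>Linear independence in explicit form, for comparing coefficients in sums over the
  basis.\<close>

lemma ext_basis_lincomb_eq_0_iff:
  assumes h: "field_hom h" and \<Gamma>: "ext_basis h \<Gamma>"
  shows "(\<Sum>b\<in>set \<Gamma>. h (c b) * b) = 0 \<longleftrightarrow> (\<forall>b\<in>set \<Gamma>. c b = 0)"
proof -
  interpret field_hom h by fact
  interpret vector_space "ext_scale h" by (rule vector_space_ext_scale[OF h])
  have "\<not> dependent (set \<Gamma>)" using \<Gamma> by (simp add: ext_basis_def)
  then show ?thesis by (auto simp: dependent_finite ext_scale_def)
qed

lemma ext_basis_representation:
  assumes h: "field_hom h" and \<Gamma>: "ext_basis h \<Gamma>"
  shows "(\<Sum>b\<in>set \<Gamma>. h (module.representation (ext_scale h) (set \<Gamma>) a b) * b) = a"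
proof -
  interpret vector_space "ext_scale h" by (rule vector_space_ext_scale[OF h])
  show ?thesis
    using \<Gamma> sum_representation_eq[of "set \<Gamma>" a "set \<Gamma>"] by (simp add: ext_basis_def ext_scale_def)
qed

text \<open>Coordinates identify the large field with the functions from \<open>set \<Gamma>\<close>
  to the small one: independence gives injectivity, spanning gives surjectivity.\<close>

lemma card_UNIV_ext:
  fixes h :: "'k::{field,finite} \<Rightarrow> 'l::field"
  assumes h: "field_hom h" and \<Gamma>: "ext_basis h \<Gamma>"
  shows "card (UNIV :: 'l set) = card (UNIV :: 'k set) ^ ext_degree h"
proof -
  interpret h: field_hom h by fact
  interpret finite_dimensional_vector_space "ext_scale h" "set \<Gamma>"
    using vector_space_ext_scale[OF h] \<Gamma>
    by (simp add: finite_dimensional_vector_space_def finite_dimensional_vector_space_axioms_def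
      ext_basis_def)
  let ?f = "\<lambda>c. \<Sum>b\<in>set \<Gamma>. h (c b) * b"
  have "bij_betw ?f (set \<Gamma> \<rightarrow>\<^sub>E (UNIV :: 'k set)) UNIV"
    unfolding bij_betw_def
  proof
    show "inj_on ?f (set \<Gamma> \<rightarrow>\<^sub>E UNIV)"
    proof (rule inj_onI)
      fix c d :: "'l \<Rightarrow> 'k"
      assume cd: "c \<in> set \<Gamma> \<rightarrow>\<^sub>E UNIV" "d \<in> set \<Gamma> \<rightarrow>\<^sub>E UNIV" and "?f c = ?f d"
      then have "(\<Sum>b\<in>set \<Gamma>. h (c b - d b) * b) = 0"
        by (simp add: h.hom_minus left_diff_distrib sum_subtractf)
      then have "\<forall>b\<in>set \<Gamma>. c b - d b = 0" by (simp only: ext_basis_lincomb_eq_0_iff[OF h \<Gamma>])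
      with cd show "c = d" by (auto intro: PiE_ext)
    qed
    \<comment> \<open>\<open>representation\<close> is 0 outside the basis, while members of the
      function space are \<open>undefined\<close> there; hence \<open>restrict\<close>.\<close>
    have "a \<in> ?f ` (set \<Gamma> \<rightarrow>\<^sub>E UNIV)" for a
      using ext_basis_representation[OF h \<Gamma>, of a]
      by (intro image_eqI[of _ _ "restrict (representation (set \<Gamma>) a) (set \<Gamma>)"]) simp_all
    then show "?f ` (set \<Gamma> \<rightarrow>\<^sub>E UNIV) = UNIV" by blast
  qed
  from bij_betw_same_card[OF this] show ?thesis
    by (simp add: card_funcsetE ext_degree_def dim_UNIV)
qed

section \<open>Rank supports and annihilators of sets of codewords\<close>

lemma rank_support_carrier:
  fixes h :: "'k::field \<Rightarrow> 'l::field"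
  assumes "v \<in> carrier_vec n"
  shows "rank_support h \<Gamma> v \<subseteq> carrier_vec n"
proof -
  interpret vec_space "TYPE('k)" n .
  have "set (cols (coord_mat h \<Gamma> v)) \<subseteq> carrier_vec n"
    using assms cols_dim[of "coord_mat h \<Gamma> v"] by (simp add: coord_mat_def)
  then show ?thesis
    using assms span_is_subset2[of "set (cols (coord_mat h \<Gamma> v))"] by (simp add: rank_support_def col_space_def)
qed

text \<open>The columns of the coordinate matrix of \<open>v\<close>, paired with \<open>x\<close>, give the coordinates of
  \<open>v \<bullet> map_vec h x\<close>.\<close>
lemma orthogonal_rank_support_iff:
  fixes h :: "'k::field \<Rightarrow> 'l::field"
  assumes h: "field_hom h" and \<Gamma>: "ext_basis h \<Gamma>"
    and v: "v \<in> carrier_vec n" and x: "x \<in> carrier_vec n"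
  shows "(\<forall>y\<in>rank_support h \<Gamma> v. x \<bullet> y = 0) \<longleftrightarrow> v \<bullet> map_vec h x = 0"
proof -
  interpret h: field_hom h by fact
  interpret vec_space "TYPE('k)" n .
  let ?r = "module.representation (ext_scale h) (set \<Gamma>)"
  let ?A = "coord_mat h \<Gamma> v"
  have cA: "set (cols ?A) \<subseteq> carrier_vec n" using v cols_dim[of ?A] by (simp add: coord_mat_def)
  have "v \<bullet> map_vec h x = (\<Sum>i<n. v $ i * h (x $ i))"
    using x by (simp add: scalar_prod_def lessThan_atLeast0)
  also have "\<dots> = (\<Sum>i<n. (\<Sum>b\<in>set \<Gamma>. h (?r (v $ i) b) * b) * h (x $ i))"
    by (simp add: ext_basis_representation[OF h \<Gamma>])
  \<comment> \<open>With the sums exchanged, each basis element carries a coefficient from the image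
    of \<open>h\<close>, so independence applies.\<close>
  also have "\<dots> = (\<Sum>b\<in>set \<Gamma>. h (\<Sum>i<n. ?r (v $ i) b * x $ i) * b)"
    unfolding sum_distrib_right h.hom_sum
    by (subst sum.swap) (simp add: h.hom_mult mult_ac)
  finally have "v \<bullet> map_vec h x = 0 \<longleftrightarrow> (\<forall>b\<in>set \<Gamma>. (\<Sum>i<n. ?r (v $ i) b * x $ i) = 0)"
    by (simp only: ext_basis_lincomb_eq_0_iff[OF h \<Gamma>])
  also have "\<dots> \<longleftrightarrow> (\<forall>j<length \<Gamma>. x \<bullet> col ?A j = 0)"
    using v x by (auto simp: all_set_conv_all_nth scalar_prod_def coord_mat_def lessThan_atLeast0 mult.commute)
  also have "\<dots> \<longleftrightarrow> (\<forall>y\<in>set (cols ?A). x \<bullet> y = 0)"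
    by (auto simp: cols_def coord_mat_def)
  \<comment> \<open>Orthogonality passes from the columns to their span, which is the rank
    support.\<close>
  also have "\<dots> \<longleftrightarrow> x \<in> orthogonal_complement (span (set (cols ?A)))"
    unfolding in_orthogonal_complement_span[OF cA] using x by (simp add: orthogonal_complement_def)
  also have "\<dots> \<longleftrightarrow> (\<forall>y\<in>rank_support h \<Gamma> v. x \<bullet> y = 0)"
    using v x by (simp add: orthogonal_complement_def rank_support_def col_space_def)
  finally show ?thesis by simp
qed

text \<open>A basis-free substitute for the rank support, namely its orthogonal complement, with a
  condition on each codeword separately.\<close>

definition annihilator :: "('k::field \<Rightarrow> 'l::field) \<Rightarrow> nat \<Rightarrow> 'l vec set \<Rightarrow> 'k vec set" where
  "annihilator h n S = {x \<in> carrier_vec n. \<forall>v\<in>S. v \<bullet> map_vec h x = 0}"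

text \<open>A set and its span have the same complement, so the sum of the rank supports may be
  replaced by their union and each \<open>v\<close> treated alone.\<close>

lemma orthogonal_complement_rank_support_set:
  fixes h :: "'k::field \<Rightarrow> 'l::field"
  assumes h: "field_hom h" and \<Gamma>: "ext_basis h \<Gamma>" and S: "S \<subseteq> carrier_vec n"
  shows "vec_module.orthogonal_complement n (rank_support_set h \<Gamma> n S) = annihilator h n S"
proof -
  interpret vec_space "TYPE('k)" n .
  have "(\<Union>v\<in>S. rank_support h \<Gamma> v) \<subseteq> carrier_vec n"
    using S rank_support_carrier by blast
  then have "orthogonal_complement (rank_support_set h \<Gamma> n S)
      = orthogonal_complement (\<Union>v\<in>S. rank_support h \<Gamma> v)"
    by (simp add: rank_support_set_def)
  also have "\<dots> = annihilator h n S"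
    unfolding orthogonal_complement_def annihilator_def
  proof (rule Collect_cong, rule conj_cong[OF refl])
    fix x :: "'k vec" assume "x \<in> carrier_vec n"
    then have "(\<forall>y\<in>rank_support h \<Gamma> v. x \<bullet> y = 0) \<longleftrightarrow> v \<bullet> map_vec h x = 0" if "v \<in> S" for v
      using that S by (intro orthogonal_rank_support_iff[OF h \<Gamma>]) auto
    then show "(\<forall>y\<in>\<Union>v\<in>S. rank_support h \<Gamma> v. x \<bullet> y = 0) \<longleftrightarrow> (\<forall>v\<in>S. v \<bullet> map_vec h x = 0)"
      by blast
  qed
  finally show ?thesis .
qed

lemma subspace_rank_support_set:
  fixes h :: "'k::field \<Rightarrow> 'l::field"
  assumes S: "S \<subseteq> carrier_vec n"
  shows "subspace class_ring (rank_support_set h \<Gamma> n S) (module_vec TYPE('k) n)"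
proof -
  interpret vec_space "TYPE('k)" n .
  have "(\<Union>v\<in>S. rank_support h \<Gamma> v) \<subseteq> carrier_vec n"
    using S rank_support_carrier by blast
  then show ?thesis unfolding rank_support_set_def by (intro span_is_subspace) simp
qed

text \<open>Complementation is injective on subspaces, being its own inverse.\<close>

lemma rank_support_set_eq_iff:
  fixes h :: "'k::{field,finite} \<Rightarrow> 'l::field"
  assumes h: "field_hom h" and \<Gamma>: "ext_basis h \<Gamma>" and S: "S \<subseteq> carrier_vec n"
    and W: "subspace class_ring W (module_vec TYPE('k) n)"
  shows "rank_support_set h \<Gamma> n S = W \<longleftrightarrow> annihilator h n S = vec_module.orthogonal_complement n W"
  using orthogonal_complement_rank_support_set[OF h \<Gamma> S]
    orthogonal_complement_orthogonal_complement[OF W]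
    orthogonal_complement_orthogonal_complement[OF subspace_rank_support_set[OF S]]
  by metis

text \<open>As \<open>h\<close> is a homomorphism, \<open>v \<bullet> map_vec h x\<close> is linear
  in \<open>x\<close> over the small field.\<close>

lemma subspace_annihilator:
  fixes h :: "'k::field \<Rightarrow> 'l::field"
  assumes h: "field_hom h" and S: "S \<subseteq> carrier_vec n"
  shows "subspace class_ring (annihilator h n S) (module_vec TYPE('k) n)"
proof -
  interpret h: field_hom h by fact
  have "map_vec h (x + y) = map_vec h x + map_vec h y"
    if "x \<in> carrier_vec n" "y \<in> carrier_vec n" for x y
    using that by (intro eq_vecI) (auto simp: h.hom_add)
  moreover have "map_vec h (c \<cdot>\<^sub>v x) = h c \<cdot>\<^sub>v map_vec h x" for c x
    by (intro eq_vecI) (auto simp: h.hom_mult)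
  moreover have "v \<bullet> map_vec h (0\<^sub>v n) = 0" if "v \<in> S" for v
  proof -
    have "map_vec h (0\<^sub>v n) = 0\<^sub>v n" by (intro eq_vecI) auto
    then show ?thesis using that S by (metis scalar_prod_right_zero subsetD)
  qed
  ultimately show ?thesis
    using S by (auto simp: subspace_vec_iff annihilator_def subset_iff scalar_prod_add_distrib[of _ n])
qed

text \<open>Rank-nullity in cardinalities. The \<open>x\<close> whose codeword \<open>?T x\<close>
  annihilates \<open>V\<close> form the complement \<open>?D\<close> of a span of dimension
  \<open>induced_rank h G V\<close>, and the kernel of \<open>?T\<close> is the complement
  \<open>?N\<close> belonging to the whole space. The quotient of their sizes counts codewords even
  when the rows of \<open>G\<close> are dependent.\<close>

lemma card_codewords_orthogonal:
  fixes h :: "'k::{field,finite} \<Rightarrow> 'l::{field,finite}"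
  assumes h: "field_hom h" and G: "G \<in> carrier_mat k n"
    and V: "subspace class_ring V (module_vec TYPE('k) n)"
  shows "card {v \<in> vec_space.row_space n G. V \<subseteq> annihilator h n {v}}
    = card (UNIV :: 'l set) ^ (induced_rank h G (carrier_vec n) - induced_rank h G V)"
proof -
  interpret h: field_hom h by fact
  interpret L: vec_space "TYPE('l)" k .
  let ?E = "carrier_vec n :: 'k vec set" and ?q = "card (UNIV :: 'l set)"
  let ?S = "\<lambda>V. L.span (ext_mult h G ` V)" and ?T = "\<lambda>x. G\<^sup>T *\<^sub>v x"
  have [simp]: "dim_row G = k" "dim_col G = n" using G by auto
  have E: "subspace class_ring ?E (module_vec TYPE('k) n)" by (auto simp: subspace_vec_iff)
  have VE: "V \<subseteq> ?E" using V by (auto simp: subspace_vec_iff)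
  have sub: "ext_mult h G ` V \<subseteq> carrier_vec k" for V
    using ext_mult_image_carrier[OF h, of G V] by simp
  have S: "subspace class_ring (?S V) (module_vec TYPE('l) k)" for V
    by (rule L.span_is_subspace) (use sub in simp)
  have cardS: "card (?S V) = ?q ^ induced_rank h G V"
    if "subspace class_ring V (module_vec TYPE('k) n)" for V
    using card_span_ext_mult[OF h, of V G] that by simp
  \<comment> \<open>Transposing moves \<open>G\<close> to the other factor, where it forms
    \<open>ext_mult\<close>.\<close>
  have adj: "?T x \<bullet> map_vec h y = x \<bullet> ext_mult h G y"
    if "x \<in> carrier_vec k" "y \<in> ?E" for x y
    using transpose_vec_mult_scalar[OF G _ that(1), of "map_vec h y"] that(2)
    by (simp add: ext_mult_def[OF h])
  have mem_orth: "x \<in> L.orthogonal_complement (?S V) \<longleftrightarrow>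
      x \<in> carrier_vec k \<and> (\<forall>y\<in>V. ?T x \<bullet> map_vec h y = 0)" if "V \<subseteq> ?E" for x V
    unfolding L.in_orthogonal_complement_span[OF sub]
    using that adj by (auto simp: L.orthogonal_complement_def subset_iff)
  have T0: "?T x = 0\<^sub>v n \<longleftrightarrow> x \<in> L.orthogonal_complement (?S ?E)" if x: "x \<in> carrier_vec k" for x
  proof
    assume "?T x = 0\<^sub>v n"
    then show "x \<in> L.orthogonal_complement (?S ?E)" using x by (auto simp: mem_orth)
  next
    assume orth: "x \<in> L.orthogonal_complement (?S ?E)"
    have "?T x $ i = 0" if i: "i < n" for i
    proof -
      \<comment> \<open>Since \<open>h\<close> fixes 0 and 1, unit vectors come from the small
        field, and these detect every coordinate of \<open>?T x\<close>.\<close>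
      have "map_vec h (unit_vec n i) = unit_vec n i" by (intro eq_vecI) (auto simp: unit_vec_def)
      then have "?T x \<bullet> unit_vec n i = 0" using orth by (simp add: mem_orth) (metis unit_vec_carrier)
      then show ?thesis using i by (metis scalar_prod_right_unit)
    qed
    then show "?T x = 0\<^sub>v n" by (intro eq_vecI) auto
  qed
  let ?D = "L.orthogonal_complement (?S V)" and ?N = "L.orthogonal_complement (?S ?E)"
  have D: "subspace class_ring ?D (module_vec TYPE('l) k)"
    using S[of V] by (intro subspace_orthogonal_complement) (auto simp: subspace_vec_iff)
  have DE: "?D \<subseteq> carrier_vec k" using D by (auto simp: subspace_vec_iff)
  have "card ?D = card ?N * card (?T ` ?D)"
  proof (rule card_kernel_times_image[OF subspace_vec_finite[OF D] DE])
    show "x + y \<in> ?D" if "x \<in> ?D" "y \<in> ?D" for x y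
      using D that by (auto simp: subspace_vec_iff)
    show "?N \<subseteq> ?D" using VE by (auto simp: mem_orth subset_iff)
    fix x y assume "x \<in> ?D" "y \<in> ?D"
    then have xy: "x \<in> carrier_vec k" "y \<in> carrier_vec k" using DE by auto
    then have diff: "?T (x - y) = ?T x - ?T y" using G by (intro mult_minus_distrib_mat_vec[of _ n k]) auto
    have "?T x \<in> carrier_vec n" "?T y \<in> carrier_vec n" by (auto intro: carrier_vecI)
    then have "?T x = ?T y \<longleftrightarrow> ?T (x - y) = 0\<^sub>v n" unfolding diff by (auto simp: vec_eq_iff)
    then show "?T x = ?T y \<longleftrightarrow> x - y \<in> ?N" using T0[of "x - y"] xy by simp
  qed
  moreover have "{v \<in> vec_space.row_space n G. V \<subseteq> annihilator h n {v}} = ?T ` ?D"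
    using VE unfolding vec_space.row_space_eq[OF G]
    by (auto simp: annihilator_def mem_orth subset_iff intro!: imageI carrier_vecI)
  ultimately have "card ?D = card ?N * card {v \<in> vec_space.row_space n G. V \<subseteq> annihilator h n {v}}"
    by simp
  \<comment> \<open>Scaling by both powers of \<open>?q\<close> lets the complement formula replace
    \<open>card ?D\<close> and \<open>card ?N\<close> without division.\<close>
  then have "?q ^ induced_rank h G V * (?q ^ induced_rank h G ?E * card ?D) = ?q ^ induced_rank h G V *
     ((?q ^ induced_rank h G ?E * card ?N) * card {v \<in> vec_space.row_space n G. V \<subseteq> annihilator h n {v}})"
    by simp
  moreover have "?q ^ induced_rank h G V * card ?D = ?q ^ k" "?q ^ induced_rank h G ?E * card ?N = ?q ^ k"
    using card_orthogonal_complement[OF S[of V], unfolded cardS[OF V]]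
      card_orthogonal_complement[OF S[of ?E], unfolded cardS[OF E]] .
  ultimately have "?q ^ k * ?q ^ induced_rank h G ?E
      = ?q ^ k * (?q ^ induced_rank h G V * card {v \<in> vec_space.row_space n G. V \<subseteq> annihilator h n {v}})"
    by (metis (no_types, lifting) mult.assoc mult.commute)
  moreover have "?q ^ k \<noteq> 0" using card_field_gt_1[where 'a='l] by simp
  ultimately have "?q ^ induced_rank h G ?E
      = ?q ^ induced_rank h G V * card {v \<in> vec_space.row_space n G. V \<subseteq> annihilator h n {v}}"
    using mult_left_cancel by blast
  \<comment> \<open>Monotonicity keeps the difference in the exponent from truncating.\<close>
  moreover have "induced_rank h G V \<le> induced_rank h G ?E"
    using induced_rank_le[OF h, of V G ?E] V E VE by simp
  then have "?q ^ induced_rank h G ?E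
      = ?q ^ induced_rank h G V * ?q ^ (induced_rank h G ?E - induced_rank h G V)"
    by (simp flip: power_add)
  ultimately show ?thesis by simp
qed

section \<open>Counting tuples with a prescribed rank support\<close>

theorem theorem6p20:
  fixes h :: "'k::{field, finite} \<Rightarrow> 'l::{field, finite}"
    and \<Gamma> :: "'l list"
    and C :: "'l vec set"
    and G :: "'l mat"
    and M :: "('k, 'k vec) qmat"
    and W :: "'k vec set"
    and q m n k t :: nat
  assumes "field_hom h"
    and "q = card (UNIV :: 'k set)"
    and "m = ext_degree h"
    and "ext_basis h \<Gamma>"
    and "subspace class_ring C (module_vec TYPE('l) n)"
    and "G \<in> carrier_mat k n"
    and "vec_space.row_space n G = C"
    and "M = induced_q_matroid h G"
    and "subspace class_ring W (module_vec TYPE('k) n)"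
    and "t > 0"
  shows "int (card {vs :: 'l vec list. length vs = t \<and> set vs \<subseteq> C \<and>
                                       rank_support_set h \<Gamma> n (set vs) = W}) =
         poly (characteristic_poly (contraction M (vec_module.orthogonal_complement n W)))
              (int (q ^ (m * t)))"
proof -
  let ?E = "module_vec TYPE('k) n" and ?\<rho> = "induced_rank h G"
  define U where "U = vec_module.orthogonal_complement n W"
  define T where "T = {vs. set vs \<subseteq> C \<and> length vs = t}"
  define \<mu> where "\<mu> = moebius (subspaces (quot_space ?E U)) {\<zero>\<^bsub>quot_space ?E U\<^esub>}"
  define pre where "pre X = {y \<in> carrier ?E. quot_proj ?E U y \<in> X}" for X
  have CE: "C \<subseteq> carrier_vec n" using assms(5) by (simp add: subspace_vec_iff)
  have finC: "finite C" by (rule subspace_vec_finite[OF assms(5)])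
  have finT: "finite T" unfolding T_def by (rule finite_lists_length_eq[OF finC])
  have W: "W \<subseteq> carrier_vec n" using assms(9) by (simp add: subspace_vec_iff)
  have U: "subspace class_ring U ?E" unfolding U_def by (rule subspace_orthogonal_complement[OF W])
  have E: "subspace class_ring (carrier_vec n) ?E" by (auto simp: subspace_vec_iff)
  have [simp]: "dim_col G = n" using assms(6) by simp
  have [simp]: "carrier ?E = carrier_vec n" by (simp add: module_vec_simps)
  have T_carrier: "set vs \<subseteq> carrier_vec n" if "vs \<in> T" for vs using that CE by (auto simp: T_def)
  have Q: "card (UNIV :: 'l set) = q ^ m" using card_UNIV_ext[OF assms(1,4)] assms(2,3) by simp
  have pre: "subspace class_ring (pre X) ?E" "U \<subseteq> pre X" "pre X \<subseteq> carrier_vec n"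
    if "X \<in> subspaces (quot_space ?E U)" for X
    using subspace_quot_proj_vimage[OF U, of X] that by (auto simp: pre_def)
  \<comment> \<open>This lets the two subtractions of \<open>?\<rho> U\<close> made by the
    contraction cancel in the exponent.\<close>
  have rank_le: "?\<rho> U \<le> ?\<rho> (pre X)" if "X \<in> subspaces (quot_space ?E U)" for X
    using induced_rank_le[OF assms(1), of U G "pre X"] U pre[OF that] by simp
  \<comment> \<open>The total rank of the contraction is evaluated at this preimage.\<close>
  have pre_top: "pre (carrier (quot_space ?E U)) = carrier_vec n"
    by (auto simp: pre_def carrier_quot_space[OF U])
  \<comment> \<open>A tuple annihilates \<open>V\<close> iff each entry does, so the number of such
    codewords is raised to the power \<open>t\<close>.\<close>
  have count: "card {vs \<in> T. V \<subseteq> annihilator h n (set vs)} = (q ^ (m * t)) ^ (?\<rho> (carrier_vec n) - ?\<rho> V)"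
    if V: "subspace class_ring V ?E" for V
  proof -
    have "V \<subseteq> carrier_vec n" using V by (simp add: subspace_vec_iff)
    then have "{vs \<in> T. V \<subseteq> annihilator h n (set vs)}
        = {vs. set vs \<subseteq> {v \<in> C. V \<subseteq> annihilator h n {v}} \<and> length vs = t}"
      by (auto simp: T_def annihilator_def subset_iff)
    then have "card {vs \<in> T. V \<subseteq> annihilator h n (set vs)} = card {v \<in> C. V \<subseteq> annihilator h n {v}} ^ t"
      using finC by (simp add: card_lists_length_eq)
    also have "\<dots> = (q ^ (m * t)) ^ (?\<rho> (carrier_vec n) - ?\<rho> V)"
      unfolding assms(7)[symmetric] card_codewords_orthogonal[OF assms(1,6) V] Q
      by (simp flip: power_mult) (simp add: mult_ac)
    finally show ?thesis .
  qed
  have "{vs. length vs = t \<and> set vs \<subseteq> C \<and> rank_support_set h \<Gamma> n (set vs) = W}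
      = {vs \<in> T. annihilator h n (set vs) = U}"
    using rank_support_set_eq_iff[OF assms(1,4) _ assms(9)] T_carrier by (auto simp: T_def U_def)
  then have "int (card {vs. length vs = t \<and> set vs \<subseteq> C \<and> rank_support_set h \<Gamma> n (set vs) = W})
      = int (card {vs \<in> T. annihilator h n (set vs) = U})"
    by (rule arg_cong)
  \<comment> \<open>The inversion is applied to the family that sends a tuple to the annihilator of
    its entries.\<close>
  also have "\<dots> = (\<Sum>X\<in>subspaces (quot_space ?E U).
      \<mu> X * int (card {vs \<in> T. pre X \<subseteq> annihilator h n (set vs)}))"
    unfolding \<mu>_def pre_def
    by (rule sum_moebius_quot_space[OF U _ finT, symmetric])
      (simp_all add: finite_carrier_vec subspace_annihilator[OF assms(1) T_carrier])
  also have "\<dots> = (\<Sum>X\<in>subspaces (quot_space ?E U).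
      \<mu> X * int (q ^ (m * t)) ^ ((?\<rho> (carrier_vec n) - ?\<rho> U) - (?\<rho> (pre X) - ?\<rho> U)))"
    using count pre(1) rank_le by (intro sum.cong refl) simp
  also have "\<dots> = poly (characteristic_poly (contraction M U)) (int (q ^ (m * t)))"
    using pre_top
    by (simp add: characteristic_poly_def contraction_def assms(8) induced_q_matroid_def
      poly_sum poly_monom \<mu>_def pre_def)
  finally show ?thesis by (simp only: U_def)
qed

end
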